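(* Let $X_1,X_2,\ldots$ be i.i.d. integer-valued random variables whose common distribution has support bounded from below. Let $S_0=0$, $S_n=X_1+\cdots+X_n$, and let $M_n=\max\{0,X_n,X_n+X_{n-1},\ldots,X_n+\cdots+X_1\}$ for $n\ge 1$, $M_0=0$. Then for all complex $u,z$ with $|u|<1$ and $|z|\le 1$, $$\sum_{n\ge 0}u^n\,\mathbb{E}\big(z^{M_n}\big)=\exp\Big\{\sum_{l=1}^{\infty}\frac{u^l}{l}\,\mathbb{E}\big(z^{S_l^+}\big)\Big\}.$$
   Context: Notation: $x^+=\max(0,x)$, and $z^0=1$ for all $z$ (including $z=0$). The process $(M_n)_{n\ge 0}$ satisfies the Lindley recursion $M_{n+1}=(M_n+X_{n+1})^+$ with $M_0=0$, and takes values in the nonnegative integers. *)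

theory Defs
  imports "HOL-Probability.Probability"
begin

definition partial_sum :: "(nat \<Rightarrow> 'a \<Rightarrow> int) \<Rightarrow> nat \<Rightarrow> 'a \<Rightarrow> int" where
  "partial_sum X n \<omega> = (\<Sum>i=1..n. X i \<omega>)"

definition backward_max :: "(nat \<Rightarrow> 'a \<Rightarrow> int) \<Rightarrow> nat \<Rightarrow> 'a \<Rightarrow> int" where
  "backward_max X n \<omega> = Max (insert 0 ((\<lambda>k. \<Sum>i=k..n. X i \<omega>) ` {1..n}))"

end

theory Submission
  imports Defs "HOL-Computational_Algebra.Formal_Laurent_Series"
begin

unbundle fps_syntax

text \<open>
  Wendel's algebraic argument. Represent a law on the integers, bounded below, by the Laurent
  series $f$ of its probabilities, so that convolution is multiplication, and let $P$ be the
  linear map induced by $x \mapsto x^+$. In terms of distribution functions $P$ is truncation,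
  $P f = (1-X) \, T(f/(1-X))$ with $T$ the regular part, so its kernel is the set of
  $(1-X)q$ with $q$ supported on the negative integers, which is closed under products.
  Let $g$ be the law of $X_1$ and $G = \sum_n G_n u^n = \exp(\sum_l P(g^l) u^l / l)$.
  Then $(1-ug)G = \exp(-\sum_l (g^l - P(g^l)) u^l / l)$ is $1$ plus a series with coefficients in
  that kernel; applying $P$ gives $G_{n+1} = P(g G_n)$, which is the Lindley recursion for the
  law of $M_n$. To avoid composing formal series, the exponential is replaced by its logarithmic
  derivative, i.e. by the recursion $(n+1)G_{n+1} = \sum_{i \le n} P(g^{i+1}) G_{n-i}$.
\<close>

section \<open>The linear map induced by the positive part, and its kernel\<close>

definition nonneg_proj :: "'a::field fls \<Rightarrow> 'a fps" where
  "nonneg_proj f = (1 - fps_X) * fls_regpart (f / (1 - fls_X))"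

definition proj_null :: "'a::field fls \<Rightarrow> bool" where
  "proj_null f \<longleftrightarrow> (\<exists>q. (\<forall>k\<ge>0. q $$ k = 0) \<and> f = (1 - fls_X) * q)"

text \<open>Coefficients in u of the exponential of the sum over l \<ge> 1 of b(l-1) u^l / l. The
  index of \<open>b\<close> is shifted by one so that \<open>b\<close> lists the coefficients of the
  derivative of the exponent.\<close>

fun spitzer_seq :: "(nat \<Rightarrow> 'a::field_char_0 fps) \<Rightarrow> nat \<Rightarrow> 'a fps" where
  "spitzer_seq b 0 = 1"
| "spitzer_seq b (Suc n) =
     fps_const (1 / of_nat (Suc n)) * (\<Sum>i\<le>n. b i * spitzer_seq b (n - i))"

lemma one_minus_fls_X: "1 - fls_X = fps_to_fls (1 - fps_X :: 'a::field fps)"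
  by (simp add: fps_X_to_fls)

lemma fls_X_neq_1 [simp]: "fls_X \<noteq> (1 :: 'a::field fls)"
proof
  assume "fls_X = (1 :: 'a fls)"
  then have "(fls_X :: 'a fls) $$ 0 = 1 $$ 0" by simp
  then show False by simp
qed

lemma nonneg_proj_one_minus_fls_X_times:
  "nonneg_proj ((1 - fls_X) * f) = (1 - fps_X) * fls_regpart (f :: 'a::field fls)"
  by (simp add: nonneg_proj_def)

lemma fls_times_supported_neg:
  fixes f g :: "'a::field fls"
  assumes "\<And>k. k \<ge> 0 \<Longrightarrow> f $$ k = 0" "\<And>k. k > 0 \<Longrightarrow> g $$ k = 0" "n \<ge> 0"
  shows "(f * g) $$ n = 0"
  unfolding fls_times_nth(2)
proof (rule sum.neutral, rule ballI)
  fix i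
  show "f $$ i * g $$ (n - i) = 0"
    using assms by (cases "i \<ge> 0") auto
qed

lemma proj_null_0 [simp]: "proj_null 0"
  unfolding proj_null_def by (rule exI[of _ 0]) simp

lemma proj_null_add: "proj_null f \<Longrightarrow> proj_null g \<Longrightarrow> proj_null (f + g)"
  unfolding proj_null_def
  by clarify (rule_tac x="q + qa" in exI, simp add: algebra_simps)

lemma proj_null_sum: "(\<And>i. i \<in> A \<Longrightarrow> proj_null (f i)) \<Longrightarrow> proj_null (sum f A)"
  by (induction A rule: infinite_finite_induct) (auto intro: proj_null_add)

text \<open>One factor 1 - X is kept outside and the other is absorbed into \<open>q\<close>: it
  raises exponents by at most one, so (1 - X) q still has no positive exponents, and its product
  with \<open>p\<close> has only negative ones.\<close>

lemma proj_null_mult: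
  fixes f g :: "'a::field fls"
  assumes "proj_null f" "proj_null g"
  shows "proj_null (f * g)"
proof -
  obtain p q where p: "\<And>k. k \<ge> 0 \<Longrightarrow> p $$ k = 0" "f = (1 - fls_X) * p"
    and q: "\<And>k. k \<ge> 0 \<Longrightarrow> q $$ k = 0" "g = (1 - fls_X) * q"
    using assms unfolding proj_null_def by blast
  have "((1 - fls_X) * q) $$ k = 0" if "k > 0" for k
    using that q(1) by (simp add: algebra_simps fls_X_times_conv_shift)
  then have "\<forall>k\<ge>0. (p * ((1 - fls_X) * q)) $$ k = 0"
    using fls_times_supported_neg[of p "(1 - fls_X) * q"] p(1) by blast
  moreover have "f * g = (1 - fls_X) * (p * ((1 - fls_X) * q))"
    using p q by (simp add: mult_ac)
  ultimately show ?thesis unfolding proj_null_def by blast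
qed

text \<open>Multiplying \<open>q\<close> by a constant does not enlarge its support, and positive
  integers are invertible in characteristic zero. This is needed because comparing coefficients in a
  differential equation yields n + 1 times the coefficient of interest.\<close>

lemma proj_null_cancel_of_nat:
  fixes f :: "'a::field_char_0 fls"
  assumes "proj_null (of_nat (Suc n) * f)"
  shows "proj_null f"
proof -
  obtain q where q: "\<And>k. k \<ge> 0 \<Longrightarrow> q $$ k = 0" "of_nat (Suc n) * f = (1 - fls_X) * q"
    using assms unfolding proj_null_def by blast
  define c :: "'a fls" where "c = fls_const (1 / of_nat (Suc n))"
  have c: "c * of_nat (Suc n) = 1"
    unfolding c_def fls_of_nat fls_const_mult_const by (simp del: of_nat_Suc)
  have "f = (c * of_nat (Suc n)) * f" unfolding c by simp
  also have "\<dots> = (1 - fls_X) * (c * q)" using q(2) by (simp add: mult_ac)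
  finally have "f = (1 - fls_X) * (c * q)" .
  moreover have "\<forall>k\<ge>0. (c * q) $$ k = 0" using q(1) by (simp add: c_def)
  ultimately show ?thesis unfolding proj_null_def by blast
qed

text \<open>With f = (1 - X) F, the difference is 1 - X times (regular part of F) - F, and the
  latter has negative exponents only.\<close>

lemma proj_null_nonneg_proj_diff: "proj_null (fps_to_fls (nonneg_proj f) - f)"
proof -
  define F where "F = f / (1 - fls_X)"
  have f: "f = (1 - fls_X) * F" by (simp add: F_def)
  have "fps_to_fls (nonneg_proj f) - f = (1 - fls_X) * (fps_to_fls (fls_regpart F) - F)"
    unfolding nonneg_proj_def F_def[symmetric] fls_times_fps_to_fls one_minus_fls_X[symmetric]
    by (subst f) (simp add: algebra_simps)
  then show ?thesis unfolding proj_null_def by (intro exI[of _ "fps_to_fls (fls_regpart F) - F"]) auto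
qed

text \<open>Power series and the kernel are complementary: dividing by 1 - X keeps a power series a
  power series and turns a kernel element into a series that the regular part kills.\<close>

lemma nonneg_proj_unique:
  assumes "proj_null (fps_to_fls h - f)"
  shows "h = nonneg_proj f"
proof -
  obtain q where q: "\<And>k. k \<ge> 0 \<Longrightarrow> q $$ k = 0" "fps_to_fls h - f = (1 - fls_X) * q"
    using assms unfolding proj_null_def by blast
  define F where "F = f / (1 - fls_X)"
  have f: "f = (1 - fls_X) * F" by (simp add: F_def)
  define k where "k = h * inverse (1 - fps_X)"
  have h: "h = (1 - fps_X) * k"
    unfolding k_def by (simp add: mult.left_commute[of _ h] inverse_mult_eq_1')
  have "(1 - fls_X) * fps_to_fls k = (1 - fls_X) * (F + q)"
    using q(2) unfolding h fls_times_fps_to_fls one_minus_fls_X[symmetric] f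
    by (simp add: algebra_simps)
  then have "fps_to_fls k = F + q" by simp
  then have "fls_regpart (fps_to_fls k) = fls_regpart (F + q)" by simp
  moreover have "fls_regpart q = 0" using q(1) by (auto intro!: fps_ext)
  ultimately have "k = fls_regpart F" by simp
  then show ?thesis unfolding nonneg_proj_def F_def[symmetric] h by simp
qed

section \<open>Wendel's argument for formal series\<close>

lemma fps_to_fls_sum: "fps_to_fls (sum f A) = (\<Sum>i\<in>A. fps_to_fls (f i))"
  by (induction A rule: infinite_finite_induct) auto

lemma fps_deriv_eq_mult_nth:
  fixes H D :: "'a::comm_ring_1 fps"
  assumes "fps_deriv H = D * H"
  shows "of_nat (Suc n) * H $ Suc n = (\<Sum>i\<le>n. D $ i * H $ (n - i))"
proof -
  have "fps_deriv H $ n = (D * H) $ n" using assms by simp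
  then show ?thesis by (simp add: fps_mult_nth atLeast0AtMost)
qed

lemma spitzer_seq_rec:
  "of_nat (Suc n) * spitzer_seq b (Suc n) = (\<Sum>i\<le>n. b i * spitzer_seq b (n - i))"
proof -
  have "of_nat (Suc n) * fps_const (1 / of_nat (Suc n)) = (1 :: 'a fps)"
    unfolding fps_of_nat[symmetric] fps_const_mult by (simp del: of_nat_Suc)
  then show ?thesis
    unfolding spitzer_seq.simps mult.assoc[symmetric] by (simp del: of_nat_Suc)
qed

text \<open>The proof uses power series in u whose coefficients are Laurent series in X; in
  \<open>H\<close> and \<open>E\<close>, therefore, \<open>fps_X\<close> stands for u. The series
  \<open>D\<close> and \<open>E\<close> are the logarithmic derivatives of G and of 1/(1 - u g), so
  \<open>D - E\<close> is that of \<open>H\<close>.\<close>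

lemma spitzer_seq_Suc:
  fixes g :: "'a::field_char_0 fls"
  defines "G \<equiv> spitzer_seq (\<lambda>i. nonneg_proj (g ^ Suc i))"
  shows "G (Suc n) = nonneg_proj (g * fps_to_fls (G n))"
proof -
  define Gf where "Gf = Abs_fps (\<lambda>n. fps_to_fls (G n))"
  define D where "D = Abs_fps (\<lambda>i. fps_to_fls (nonneg_proj (g ^ Suc i)))"
  define E where "E = Abs_fps (\<lambda>i. g ^ Suc i)"
  define H where "H = (1 - fps_const g * fps_X) * Gf"
  have Gn: "of_nat (Suc n) * G (Suc n) = (\<Sum>i\<le>n. nonneg_proj (g ^ Suc i) * G (n - i))" for n
    unfolding G_def by (rule spitzer_seq_rec)
  have derivG: "fps_deriv Gf = D * Gf"
  proof (rule fps_ext)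
    fix n
    have "fps_deriv Gf $ n = fps_to_fls (of_nat (Suc n) * G (Suc n))"
      by (simp add: Gf_def fls_times_fps_to_fls fps_to_fls_of_nat del: of_nat_Suc)
    also have "\<dots> = (D * Gf) $ n"
      unfolding Gn by (simp add: fps_mult_nth D_def Gf_def fps_to_fls_sum fls_times_fps_to_fls atLeast0AtMost)
    finally show "fps_deriv Gf $ n = (D * Gf) $ n" .
  qed
  \<comment> \<open>The geometric series: \<open>E\<close> is g / (1 - u g).\<close>
  have E: "(1 - fps_const g * fps_X) * E = fps_const g"
  proof (rule fps_ext)
    fix n
    show "((1 - fps_const g * fps_X) * E) $ n = fps_const g $ n"
      by (cases n) (simp_all add: E_def algebra_simps mult.assoc)
  qed
  have "fps_deriv H = - fps_const g * Gf + (1 - fps_const g * fps_X) * (D * Gf)"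
    unfolding H_def by (simp add: derivG algebra_simps flip: fps_const_neg)
  also have "\<dots> = - ((1 - fps_const g * fps_X) * E) * Gf + (1 - fps_const g * fps_X) * (D * Gf)"
    unfolding E ..
  also have "\<dots> = (D - E) * H" unfolding H_def by (simp add: algebra_simps)
  finally have derivH: "fps_deriv H = (D - E) * H" .
  have H0: "H $ 0 = 1" by (simp add: H_def Gf_def G_def)
  have DE: "proj_null ((D - E) $ i)" for i
    using proj_null_nonneg_proj_diff by (simp add: D_def E_def del: power_Suc)
  \<comment> \<open>The kernel is closed under products but \<open>H $ 0\<close> is 1, which lies
    outside it; the term with i = n is therefore handled by the coefficient of \<open>D - E\<close>
    alone, and all other terms by the induction hypothesis.\<close>
  have null: "proj_null (H $ Suc n)" for n
  proof (induction n rule: less_induct)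
    case (less n)
    have "proj_null ((D - E) $ i * H $ (n - i))" if "i \<le> n" for i
    proof (cases "n - i")
      case 0
      then show ?thesis using DE[of i] by (simp only: H0 mult_1_right)
    next
      case (Suc m)
      then have "m < n" by simp
      then show ?thesis using less proj_null_mult[OF DE] Suc by metis
    qed
    then have "proj_null (of_nat (Suc n) * H $ Suc n)"
      unfolding fps_deriv_eq_mult_nth[OF derivH] by (intro proj_null_sum) auto
    then show ?case by (rule proj_null_cancel_of_nat)
  qed
  have "H $ Suc n = fps_to_fls (G (Suc n)) - g * fps_to_fls (G n)"
    by (simp add: H_def Gf_def algebra_simps mult.assoc)
  with null[of n] show ?thesis by (intro nonneg_proj_unique) simp
qed

text \<open>The one-step recursion determines the whole sequence from its initial value, so
  \<open>A\<close> must be the sequence of coefficients of the exponential.\<close>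

lemma spitzer_recursion:
  fixes g :: "'a::field_char_0 fls"
  assumes "A 0 = 1" and "\<And>n. A (Suc n) = nonneg_proj (g * fps_to_fls (A n))"
  shows "of_nat (Suc n) * A (Suc n) = (\<Sum>i\<le>n. nonneg_proj (g ^ Suc i) * A (n - i))"
proof -
  have A: "A n = spitzer_seq (\<lambda>i. nonneg_proj (g ^ Suc i)) n" for n
    by (induction n) (simp_all only: assms spitzer_seq_Suc spitzer_seq.simps(1))
  show ?thesis unfolding A by (rule spitzer_seq_rec)
qed

section \<open>From the coefficient recursion to the exponential on the unit disc\<close>

lemma conv_radius_ge_1:
  fixes f :: "nat \<Rightarrow> complex"
  assumes "\<And>n. norm (f n) \<le> 1"
  shows "conv_radius f \<ge> 1"
proof (rule conv_radius_geI_ex')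
  fix r :: real
  assume r: "0 < r" "ereal r < 1"
  show "summable (\<lambda>n. f n * of_real r ^ n)"
  proof (rule summable_comparison_test')
    show "summable (\<lambda>n. r ^ n)" using r by (intro summable_geometric) auto
    show "norm (f n * of_real r ^ n) \<le> r ^ n" for n
      using assms[of n] r by (simp add: norm_mult norm_power mult_left_le_one_le)
  qed
qed

text \<open>The recursion says that the series A of \<open>a\<close> satisfies A' = B A. If L is the
  antiderivative of B with L(0) = 0, then A exp(-L) has derivative zero on the unit disc and equals
  1 at the origin.\<close>

lemma exp_power_series_sums:
  fixes a b :: "nat \<Rightarrow> complex"
  assumes a0: "a 0 = 1"
    and rec: "\<And>n. of_nat (Suc n) * a (Suc n) = (\<Sum>i\<le>n. b i * a (n - i))"
    and a: "\<And>n. norm (a n) \<le> 1" and b: "\<And>n. norm (b n) \<le> 1"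
    and u: "norm u < 1"
  shows "summable (\<lambda>l. u ^ Suc l / of_nat (Suc l) * b l)"
    and "(\<lambda>n. u ^ n * a n) sums exp (\<Sum>l. u ^ Suc l / of_nat (Suc l) * b l)"
proof -
  define A where "A = Abs_fps a"
  define B where "B = Abs_fps b"
  define L where "L = fps_integral0 B"
  have radA: "fps_conv_radius A \<ge> 1" and radB: "fps_conv_radius B \<ge> 1"
    unfolding fps_conv_radius_def A_def B_def using a b by (simp_all add: conv_radius_ge_1)
  have "norm (L $ n) \<le> 1" for n
  proof (cases n)
    case (Suc m)
    have "norm (L $ n) = inverse (real (Suc m)) * norm (b m)"
      unfolding Suc L_def B_def fps_integral_nth_0_Suc by (simp only: norm_mult norm_inverse norm_of_nat fps_nth_Abs_fps)
    also have "\<dots> \<le> 1 * 1" using b[of m] by (intro mult_mono) (auto simp: field_simps)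
    finally show ?thesis by simp
  qed (simp add: L_def)
  then have radL: "fps_conv_radius L \<ge> 1"
    unfolding fps_conv_radius_def by (rule conv_radius_ge_1)
  have derivA: "fps_deriv A = B * A"
    using rec by (auto intro!: fps_ext simp: fps_mult_nth A_def B_def atLeast0AtMost)
  have derivL: "fps_deriv L = B"
    by (simp add: L_def fps_deriv_fps_integral)
  have in_rad: "ereal (norm w) < fps_conv_radius A" "ereal (norm w) < fps_conv_radius B"
    "ereal (norm w) < fps_conv_radius L" if "norm w < 1" for w
    using that radA radB radL by (auto intro: less_le_trans[of _ 1])
  define h where "h = (\<lambda>w. eval_fps A w * exp (- eval_fps L w))"
  have "\<exists>c. \<forall>w\<in>ball 0 1. h w = c"
  proof (rule has_field_derivative_zero_constant)
    fix w :: complex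
    assume "w \<in> ball 0 1"
    then have w: "norm w < 1" by simp
    have dA: "(eval_fps A has_field_derivative eval_fps B w * eval_fps A w) (at w within ball 0 1)"
      using has_field_derivative_eval_fps[OF in_rad(1)[OF w]] 
      by (simp add: derivA eval_fps_mult in_rad[OF w])
    have dL: "(eval_fps L has_field_derivative eval_fps B w) (at w within ball 0 1)"
      using has_field_derivative_eval_fps[OF in_rad(3)[OF w]] by (simp add: derivL)
    show "(h has_field_derivative 0) (at w within ball 0 1)"
      unfolding h_def by (rule derivative_eq_intros dA dL refl | simp)+
  qed simp
  then obtain c where c: "\<And>w. norm w < 1 \<Longrightarrow> h w = c" by auto
  have "c = 1" using c[of 0] by (simp add: h_def eval_fps_at_0 A_def a0 L_def)
  then have "eval_fps A u = exp (eval_fps L u)"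
    using c[OF u] by (simp add: h_def exp_minus field_simps)
  moreover have "(\<lambda>n. u ^ n * a n) sums eval_fps A u"
    using sums_eval_fps[OF in_rad(1)[OF u]] by (simp add: A_def mult.commute)
  moreover have L: "(\<lambda>l. u ^ Suc l / of_nat (Suc l) * b l) sums eval_fps L u"
  \<comment> \<open>The constant term of \<open>L\<close> is zero, so the summation may start at
    exponent 1; the coefficient of u^(l+1) is \<open>b l\<close> divided by l + 1.\<close>
  proof -
    have "(\<lambda>n. L $ Suc n * u ^ Suc n) sums eval_fps L u"
      using sums_eval_fps[OF in_rad(3)[OF u]] by (subst sums_Suc_iff) (simp add: L_def)
    moreover have "L $ Suc n * u ^ Suc n = u ^ Suc n / of_nat (Suc n) * b n" for n
      by (simp add: L_def B_def divide_inverse mult_ac)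
    ultimately show ?thesis by simp
  qed
  ultimately show "(\<lambda>n. u ^ n * a n) sums exp (\<Sum>l. u ^ Suc l / of_nat (Suc l) * b l)"
    unfolding sums_unique[OF L, symmetric] by simp
  show "summable (\<lambda>l. u ^ Suc l / of_nat (Suc l) * b l)" using L by (rule sums_summable)
qed

section \<open>Laws on the integers as Laurent series\<close>

definition conv_pmf :: "int pmf \<Rightarrow> int pmf \<Rightarrow> int pmf" where
  "conv_pmf p q = map_pmf (\<lambda>(x, y). x + y) (pair_pmf p q)"

primrec conv_power_pmf :: "int pmf \<Rightarrow> nat \<Rightarrow> int pmf" where
  "conv_power_pmf p 0 = return_pmf 0"
| "conv_power_pmf p (Suc n) = conv_pmf (conv_power_pmf p n) p"

text \<open>The function \<open>nat\<close> sends negative integers to 0 and so acts as the positive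
  part. Keeping these laws on the naturals makes their generating functions power series.\<close>

primrec lindley_pmf :: "int pmf \<Rightarrow> nat \<Rightarrow> nat pmf" where
  "lindley_pmf p 0 = return_pmf 0"
| "lindley_pmf p (Suc n) = map_pmf nat (conv_pmf (map_pmf int (lindley_pmf p n)) p)"

definition fls_of_pmf :: "int pmf \<Rightarrow> real fls" where
  "fls_of_pmf p = Abs_fls (pmf p)"

definition fps_of_pmf :: "nat pmf \<Rightarrow> real fps" where
  "fps_of_pmf p = Abs_fps (pmf p)"

text \<open>Boundedness from below enters here: it makes the probabilities vanish at all
  sufficiently negative integers, so that they do form a Laurent series.\<close>

lemma fls_of_pmf_nth:
  assumes "bdd_below (set_pmf p)"
  shows "fls_of_pmf p $$ k = pmf p k"
  unfolding fls_of_pmf_def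
proof (rule nth_Abs_fls_ex_lower_bound)
  obtain m where "\<And>x. x \<in> set_pmf p \<Longrightarrow> m \<le> x" using assms by (auto simp: bdd_below_def)
  then show "\<exists>N. \<forall>n<N. pmf p n = 0" by (metis not_le pmf_eq_0_set_pmf)
qed

lemma bdd_below_conv_pmf:
  assumes "bdd_below (set_pmf p)" "bdd_below (set_pmf q)"
  shows "bdd_below (set_pmf (conv_pmf p q))"
proof -
  obtain a b where "\<And>x. x \<in> set_pmf p \<Longrightarrow> a \<le> x" "\<And>x. x \<in> set_pmf q \<Longrightarrow> b \<le> x"
    using assms by (auto simp: bdd_below_def)
  then show ?thesis
    by (intro bdd_belowI[of _ "a + b"]) (auto simp: conv_pmf_def intro: add_mono)
qed

lemma pmf_conv_pmf: "pmf (conv_pmf p q) k = (\<integral>x. pmf q (k - x) \<partial>measure_pmf p)"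
proof -
  have "conv_pmf p q = bind_pmf p (\<lambda>x. map_pmf ((+) x) q)"
    by (simp add: conv_pmf_def pair_pmf_def map_bind_pmf map_pmf_def bind_assoc_pmf bind_return_pmf)
  moreover have "pmf (map_pmf ((+) x) q) k = pmf q (k - x)" for x
    using pmf_map_inj'[of "(+) x" q "k - x"] by simp
  ultimately show ?thesis by (simp add: pmf_bind)
qed

lemma fls_of_pmf_conv:
  assumes p: "bdd_below (set_pmf p)" and q: "bdd_below (set_pmf q)"
  shows "fls_of_pmf (conv_pmf p q) = fls_of_pmf p * fls_of_pmf q"
proof (rule fls_eqI)
  fix k
  define a b where "a = fls_subdegree (fls_of_pmf p)" and "b = fls_subdegree (fls_of_pmf q)"
  \<comment> \<open>Both supports are bounded below, so only finitely many splittings of k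
    contribute and the convolution integral is the finite sum in the product of Laurent
    series.\<close>
  have "x \<in> {a..k - b}" if "x \<in> set_pmf p" "pmf q (k - x) \<noteq> 0" for x
  proof -
    have "fls_of_pmf p $$ x \<noteq> 0" "fls_of_pmf q $$ (k - x) \<noteq> 0"
      using that p q by (simp_all add: fls_of_pmf_nth set_pmf_iff)
    then have "a \<le> x" "b \<le> k - x" unfolding a_def b_def by (simp_all add: fls_subdegree_leI)
    then show ?thesis by simp
  qed
  then have "pmf (conv_pmf p q) k = (\<Sum>x\<in>{a..k - b}. pmf p x *\<^sub>R pmf q (k - x))"
    unfolding pmf_conv_pmf by (intro integral_measure_pmf) auto
  also have "\<dots> = (fls_of_pmf p * fls_of_pmf q) $$ k"
    unfolding fls_times_nth(2) a_def b_def using p q by (simp add: fls_of_pmf_nth)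
  finally show "fls_of_pmf (conv_pmf p q) $$ k = (fls_of_pmf p * fls_of_pmf q) $$ k"
    using bdd_below_conv_pmf[OF p q] by (simp add: fls_of_pmf_nth)
qed

lemma conv_power_pmf:
  assumes "bdd_below (set_pmf p)"
  shows "bdd_below (set_pmf (conv_power_pmf p n)) \<and> fls_of_pmf (conv_power_pmf p n) = fls_of_pmf p ^ n"
proof (induction n)
  case 0
  have "fls_of_pmf (return_pmf 0) = 1"
    by (rule fls_eqI) (auto simp: fls_of_pmf_nth indicator_def)
  then show ?case by simp
next
  case (Suc n)
  then show ?case using assms by (simp add: bdd_below_conv_pmf fls_of_pmf_conv mult.commute)
qed

lemma fls_of_pmf_int: "fls_of_pmf (map_pmf int p) = fps_to_fls (fps_of_pmf p)"
proof (rule fls_eqI)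
  fix k
  have "bdd_below (set_pmf (map_pmf int p))" by (intro bdd_belowI[of _ 0]) auto
  then have "fls_of_pmf (map_pmf int p) $$ k = pmf (map_pmf int p) k" by (rule fls_of_pmf_nth)
  also have "\<dots> = fps_to_fls (fps_of_pmf p) $$ k"
  proof (cases "k < 0")
    case True
    then have "k \<notin> set_pmf (map_pmf int p)" by auto
    then show ?thesis using True by (simp add: pmf_eq_0_set_pmf)
  next
    case False
    then show ?thesis using pmf_map_inj'[of int p "nat k"] by (simp add: fps_of_pmf_def)
  qed
  finally show "fls_of_pmf (map_pmf int p) $$ k = fps_to_fls (fps_of_pmf p) $$ k" .
qed

text \<open>Multiplying by $1/(1-X)$ turns probabilities into distribution functions, and the
  distribution function of the positive part is the old one cut off below $0$.\<close>

lemma nonneg_proj_fls_of_pmf: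
  assumes "bdd_below (set_pmf p)"
  shows "nonneg_proj (fls_of_pmf p) = fps_of_pmf (map_pmf nat p)"
proof -
  define F where "F = (\<lambda>k. measure_pmf.prob p {..k})"
  define C where "C = Abs_fls F"
  have C: "C $$ k = F k" for k
    unfolding C_def
  proof (rule nth_Abs_fls_ex_lower_bound)
    obtain m where m: "\<And>x. x \<in> set_pmf p \<Longrightarrow> m \<le> x" using assms by (auto simp: bdd_below_def)
    have "F k = 0" if "k < m" for k
      unfolding F_def using that m by (subst measure_pmf_zero_iff) force
    then show "\<exists>N. \<forall>n<N. F n = 0" by blast
  qed
  have pmf_F: "pmf p k = F k - F (k - 1)" for k
  proof -
    have "{..k} = {..k - 1} \<union> {k}" by auto
    moreover have "measure_pmf.prob p ({..k - 1} \<union> {k}) = F (k - 1) + measure_pmf.prob p {k}"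
      unfolding F_def by (rule measure_pmf.finite_measure_Union) auto
    ultimately have "F k = F (k - 1) + measure_pmf.prob p {k}" by (simp only: F_def)
    then show ?thesis by (simp add: measure_pmf_single)
  qed
  \<comment> \<open>Probabilities are the first differences of the distribution function, hence
    \<open>C\<close> is the quotient by 1 - X.\<close>
  have "fls_of_pmf p = (1 - fls_X) * C"
    using assms by (intro fls_eqI) (simp add: fls_of_pmf_nth pmf_F C algebra_simps fls_X_times_conv_shift)
  then have "nonneg_proj (fls_of_pmf p) = (1 - fps_X) * fls_regpart C"
    by (simp only: nonneg_proj_one_minus_fls_X_times)
  also have "\<dots> = fps_of_pmf (map_pmf nat p)"
  proof (rule fps_ext)
    fix n
    show "((1 - fps_X) * fls_regpart C) $ n = fps_of_pmf (map_pmf nat p) $ n"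
    proof (cases n)
      case 0
      \<comment> \<open>After truncation the coefficient at 0 has no predecessor to subtract, so it
        is all of \<open>F 0\<close>: the mass of the nonpositive integers is collected at
        0.\<close>
      have "nat -` {0} = {..0::int}" by auto
      then show ?thesis using 0 by (simp add: algebra_simps C fps_of_pmf_def pmf_map F_def)
    next
      case (Suc m)
      then have "nat -` {n} = {int n}" by auto
      then show ?thesis using Suc pmf_F[of "int n"]
        by (simp add: algebra_simps C fps_of_pmf_def pmf_map measure_pmf_single)
    qed
  qed
  finally show ?thesis .
qed

text \<open>A translation of the formal recursion: a Lindley step is multiplication by the series of
  \<open>p\<close> followed by the positive-part map, and the powers of that series belong to the
  convolution powers of \<open>p\<close>.\<close>

lemma spitzer_recursion_pmf:
  assumes "bdd_below (set_pmf p)"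
  shows "of_nat (Suc n) * fps_of_pmf (lindley_pmf p (Suc n)) =
    (\<Sum>i\<le>n. fps_of_pmf (map_pmf nat (conv_power_pmf p (Suc i))) * fps_of_pmf (lindley_pmf p (n - i)))"
proof -
  have "fps_of_pmf (lindley_pmf p 0) = 1"
    by (rule fps_ext) (simp add: fps_of_pmf_def indicator_def)
  moreover have "fps_of_pmf (lindley_pmf p (Suc n)) =
      nonneg_proj (fls_of_pmf p * fps_to_fls (fps_of_pmf (lindley_pmf p n)))" for n
  proof -
    have "bdd_below (set_pmf (map_pmf int (lindley_pmf p n)))" by (intro bdd_belowI[of _ 0]) auto
    then show ?thesis
      using assms by (simp add: nonneg_proj_fls_of_pmf[symmetric] bdd_below_conv_pmf
          fls_of_pmf_conv fls_of_pmf_int mult.commute)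
  qed
  moreover have "nonneg_proj (fls_of_pmf p ^ Suc i) = fps_of_pmf (map_pmf nat (conv_power_pmf p (Suc i)))" for i
    using conv_power_pmf[OF assms, of "Suc i"] nonneg_proj_fls_of_pmf[of "conv_power_pmf p (Suc i)"]
    by (simp del: power_Suc conv_power_pmf.simps)
  ultimately show ?thesis
    using spitzer_recursion[of "\<lambda>n. fps_of_pmf (lindley_pmf p n)" "fls_of_pmf p" n]
    by (simp only:)
qed

section \<open>Probability generating functions on the closed unit disc\<close>

definition pgf :: "nat pmf \<Rightarrow> complex \<Rightarrow> complex" where
  "pgf p z = (\<integral>n. z ^ n \<partial>measure_pmf p)"

lemma norm_pgf_le_1:
  assumes "norm z \<le> 1"
  shows "norm (pgf p z) \<le> 1"
proof -
  have "integrable (measure_pmf p) (\<lambda>n. z ^ n)"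
    using assms by (intro measure_pmf.integrable_const_bound[where B = 1])
      (auto simp: norm_power power_le_one)
  then have "(\<integral>n. norm (z ^ n) \<partial>measure_pmf p) \<le> (\<integral>n. 1 \<partial>measure_pmf p)"
    using assms by (intro integral_mono integrable_norm) (auto simp: norm_power power_le_one)
  then show ?thesis
    unfolding pgf_def by (intro order_trans[OF integral_norm_bound]) simp
qed

text \<open>The expectation is an integral against counting measure with density
  \<open>pmf p\<close>. Its integrability gives absolute convergence, boundary included, as the
  Cauchy product requires.\<close>

lemma pgf_sums:
  assumes "norm z \<le> 1"
  shows "summable (\<lambda>n. norm (of_real (fps_of_pmf p $ n) * z ^ n))"
    and "(\<lambda>n. of_real (fps_of_pmf p $ n) * z ^ n) sums pgf p z"
proof -
  have "integrable (measure_pmf p) (\<lambda>n. z ^ n)"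
    using assms by (intro measure_pmf.integrable_const_bound[where B = 1])
      (auto simp: norm_power power_le_one)
  then have int: "integrable (count_space UNIV) (\<lambda>n. pmf p n *\<^sub>R z ^ n)"
    unfolding measure_pmf_eq_density by (subst (asm) integrable_density) auto
  then show "summable (\<lambda>n. norm (of_real (fps_of_pmf p $ n) * z ^ n))"
    by (simp add: integrable_count_space_nat_iff fps_of_pmf_def scaleR_conv_of_real)
  have "pgf p z = (\<integral>n. pmf p n *\<^sub>R z ^ n \<partial>count_space UNIV)"
    unfolding pgf_def measure_pmf_eq_density by (subst integral_density) auto
  then show "(\<lambda>n. of_real (fps_of_pmf p $ n) * z ^ n) sums pgf p z"
    using sums_integral_count_space_nat[OF int] by (simp add: fps_of_pmf_def scaleR_conv_of_real)
qed

text \<open>Evaluation at z turns products of formal series into products of values by the Cauchy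
  product. Both sides are then sums of series with equal terms.\<close>

lemma spitzer_recursion_pgf:
  assumes "bdd_below (set_pmf p)" and z: "norm z \<le> 1"
  shows "of_nat (Suc n) * pgf (lindley_pmf p (Suc n)) z =
    (\<Sum>i\<le>n. pgf (map_pmf nat (conv_power_pmf p (Suc i))) z * pgf (lindley_pmf p (n - i)) z)"
proof -
  let ?B = "\<lambda>i. fps_of_pmf (map_pmf nat (conv_power_pmf p (Suc i)))"
  let ?A = "\<lambda>i. fps_of_pmf (lindley_pmf p i)"
  have prod: "(\<lambda>k. of_real ((fps_of_pmf q * fps_of_pmf r) $ k) * z ^ k) sums (pgf q z * pgf r z)" for q r
  proof -
    have "of_real ((fps_of_pmf q * fps_of_pmf r) $ k) * z ^ k =
      (\<Sum>i\<le>k. (of_real (fps_of_pmf q $ i) * z ^ i) * (of_real (fps_of_pmf r $ (k - i)) * z ^ (k - i)))" for k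
      unfolding fps_mult_nth atLeast0AtMost of_real_sum sum_distrib_right of_real_mult
    proof (rule sum.cong)
      fix i assume "i \<in> {..k}"
      then have "z ^ k = z ^ i * z ^ (k - i)" by (simp flip: power_add)
      then show "of_real (fps_of_pmf q $ i) * of_real (fps_of_pmf r $ (k - i)) * z ^ k =
        (of_real (fps_of_pmf q $ i) * z ^ i) * (of_real (fps_of_pmf r $ (k - i)) * z ^ (k - i))"
        by (simp only: mult_ac)
    qed simp
    then show ?thesis
      using Cauchy_product_sums[OF pgf_sums(1)[OF z, of q] pgf_sums(1)[OF z, of r]]
      by (simp only: sums_unique[OF pgf_sums(2)[OF z], symmetric])
  qed
  have "(\<lambda>k. \<Sum>i\<le>n. of_real ((?B i * ?A (n - i)) $ k) * z ^ k) sums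
    (\<Sum>i\<le>n. pgf (map_pmf nat (conv_power_pmf p (Suc i))) z * pgf (lindley_pmf p (n - i)) z)"
    by (intro sums_sum prod)
  moreover have "(\<lambda>k. of_nat (Suc n) * (of_real (?A (Suc n) $ k) * z ^ k)) sums
    (of_nat (Suc n) * pgf (lindley_pmf p (Suc n)) z)"
    by (intro sums_mult pgf_sums z)
  moreover have "(\<Sum>i\<le>n. of_real ((?B i * ?A (n - i)) $ k) * z ^ k) =
      of_nat (Suc n) * (of_real (?A (Suc n) $ k) * z ^ k)" for k
  proof -
    have "(\<Sum>i\<le>n. (?B i * ?A (n - i)) $ k) = (of_nat (Suc n) * ?A (Suc n)) $ k"
      unfolding spitzer_recursion_pmf[OF assms(1)] fps_sum_nth ..
    also have "\<dots> = of_nat (Suc n) * ?A (Suc n) $ k"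
      by (simp only: fps_of_nat[symmetric] fps_mult_left_const_nth)
    finally have "complex_of_real (\<Sum>i\<le>n. (?B i * ?A (n - i)) $ k) = of_real (of_nat (Suc n) * ?A (Suc n) $ k)"
      by (simp only:)
    then show ?thesis
      by (simp only: of_real_sum of_real_mult of_real_of_nat_eq sum_distrib_right[symmetric] mult.assoc)
  qed
  ultimately show ?thesis by (simp only: sums_unique2)
qed

section \<open>The laws of the walk and of its backward maximum\<close>

text \<open>This is the Lindley recursion. A sum ending at n + 1 is a sum ending at n shifted by
  \<open>X (Suc n) \<omega>\<close>; the one-term sum comes from shifting the inserted 0.\<close>

lemma backward_max_Suc:
  "backward_max X (Suc n) \<omega> = max 0 (backward_max X n \<omega> + X (Suc n) \<omega>)"
proof -
  let ?S = "insert 0 ((\<lambda>k. \<Sum>i=k..n. X i \<omega>) ` {1..n})"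
  have "(\<lambda>k. \<Sum>i=k..Suc n. X i \<omega>) ` {1..Suc n} =
    insert (X (Suc n) \<omega>) ((\<lambda>k. \<Sum>i=k..Suc n. X i \<omega>) ` {1..n})"
    by (simp add: atLeastAtMostSuc_conv del: sum.cl_ivl_Suc)
  also have "(\<lambda>k. \<Sum>i=k..Suc n. X i \<omega>) ` {1..n} = (\<lambda>k. (\<Sum>i=k..n. X i \<omega>) + X (Suc n) \<omega>) ` {1..n}"
    by (intro image_cong) auto
  finally have "(\<lambda>k. \<Sum>i=k..Suc n. X i \<omega>) ` {1..Suc n} = (\<lambda>s. s + X (Suc n) \<omega>) ` ?S"
    by (simp only: image_insert image_image add_0)
  then have "backward_max X (Suc n) \<omega> = max 0 (Max ((\<lambda>s. s + X (Suc n) \<omega>) ` ?S))"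
    unfolding backward_max_def by (simp only:) (rule Max_insert, auto)
  \<comment> \<open>Translation is monotone, so it commutes with taking the maximum of a finite
    nonempty set.\<close>
  also have "Max ((\<lambda>s. s + X (Suc n) \<omega>) ` ?S) = Max ?S + X (Suc n) \<omega>"
    by (intro hom_Max_commute[symmetric]) (auto simp: max_add_distrib_left)
  finally show ?thesis by (simp add: backward_max_def)
qed

text \<open>By independence the joint law is the product measure, which on a countable discrete
  space is determined by its singletons and so agrees with \<open>pair_pmf p q\<close>. This gives
  the induction step for both the partial sums and the maxima.\<close>

lemma (in prob_space) distr_indep_pmf:
  fixes p q :: "'b::countable pmf"
  assumes "indep_var (count_space UNIV) Y (count_space UNIV) Z"
    and Y: "distr M (count_space UNIV) Y = measure_pmf p"
    and Z: "distr M (count_space UNIV) Z = measure_pmf q"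
  shows "distr M (count_space UNIV) (\<lambda>\<omega>. f (Y \<omega>) (Z \<omega>)) =
    measure_pmf (map_pmf (\<lambda>(x, y). f x y) (pair_pmf p q))"
proof -
  have rv [measurable]: "random_variable (count_space UNIV) Y" "random_variable (count_space UNIV) Z"
    and joint: "measure_pmf p \<Otimes>\<^sub>M measure_pmf q =
      distr M (count_space UNIV \<Otimes>\<^sub>M count_space UNIV) (\<lambda>x. (Y x, Z x))"
    using assms unfolding indep_var_distribution_eq Y Z by auto
  have cs: "(count_space UNIV :: 'b measure) \<Otimes>\<^sub>M (count_space UNIV :: 'b measure) = count_space UNIV"
    by (simp add: pair_measure_countable)
  have pair: "measure_pmf p \<Otimes>\<^sub>M measure_pmf q = measure_pmf (pair_pmf p q)"
  proof (rule measure_eqI_countable[of _ UNIV])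
    show "sets (measure_pmf p \<Otimes>\<^sub>M measure_pmf q) = Pow UNIV"
      unfolding joint by (simp add: cs)
    fix x :: "'b \<times> 'b"
    obtain a b where x: "x = (a, b)" by force
    have "emeasure (measure_pmf p \<Otimes>\<^sub>M measure_pmf q) ({a} \<times> {b}) = ennreal (pmf p a) * ennreal (pmf q b)"
      by (subst measure_pmf.emeasure_pair_measure_Times) (auto simp: emeasure_pmf_single)
    then show "emeasure (measure_pmf p \<Otimes>\<^sub>M measure_pmf q) {x} = emeasure (measure_pmf (pair_pmf p q)) {x}"
      by (simp add: x emeasure_pmf_single pmf_pair ennreal_mult)
  qed auto
  have "distr M (count_space UNIV) (\<lambda>\<omega>. f (Y \<omega>) (Z \<omega>)) =
    distr (distr M (count_space UNIV \<Otimes>\<^sub>M count_space UNIV) (\<lambda>x. (Y x, Z x))) (count_space UNIV) (\<lambda>(x, y). f x y)"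
    by (subst distr_distr) (auto simp: comp_def cs)
  also have "\<dots> = measure_pmf (map_pmf (\<lambda>(x, y). f x y) (pair_pmf p q))"
    unfolding joint[symmetric] pair by (simp add: map_pmf_rep_eq)
  finally show ?thesis .
qed

text \<open>The index sets {1..n} and {n+1} are disjoint, so the two restricted families are
  independent, and functions of them remain so.\<close>

lemma (in prob_space) indep_var_past:
  fixes X :: "nat \<Rightarrow> 'a \<Rightarrow> 'b::countable"
  assumes "indep_vars (\<lambda>_. count_space UNIV) X {1..}"
    and past: "\<And>\<omega>. Y \<omega> = h (restrict (\<lambda>i. X i \<omega>) {1..n})"
  shows "indep_var (count_space UNIV) Y (count_space UNIV) (X (Suc n))"
proof -
  \<comment> \<open>A finite product of countable discrete spaces is again discrete, which makes an
    arbitrary \<open>h\<close> measurable.\<close>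
  have *: "(PiM A (\<lambda>_. count_space UNIV) :: (nat \<Rightarrow> 'b) measure) = count_space (PiE A (\<lambda>_. UNIV))"
    if "finite A" for A
    using that by (rule count_space_PiM_finite) auto
  have "indep_var (count_space UNIV) (h \<circ> (\<lambda>\<omega>. restrict (\<lambda>i. X i \<omega>) {1..n}))
    (count_space UNIV) ((\<lambda>f. f (Suc n)) \<circ> (\<lambda>\<omega>. restrict (\<lambda>i. X i \<omega>) {Suc n}))"
    by (rule indep_var_compose[OF indep_var_restrict[OF assms(1)]]) (auto simp: *)
  moreover have "h \<circ> (\<lambda>\<omega>. restrict (\<lambda>i. X i \<omega>) {1..n}) = Y" by (auto simp: past)
  moreover have "(\<lambda>f. f (Suc n)) \<circ> (\<lambda>\<omega>. restrict (\<lambda>i. X i \<omega>) {Suc n}) = X (Suc n)" by auto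
  ultimately show ?thesis by simp
qed

lemma (in prob_space) distr_const_pmf:
  "distr M (count_space UNIV) (\<lambda>_. c) = measure_pmf (return_pmf c)"
  by (rule measure_eqI) (auto simp: emeasure_distr emeasure_space_1 indicator_def)

locale lindley_walk = prob_space M
  for M :: "'a measure" +
  fixes X :: "nat \<Rightarrow> 'a \<Rightarrow> int" and \<mu> :: "int pmf"
  assumes indep: "indep_vars (\<lambda>_. count_space UNIV) X {1..}"
    and ident: "\<And>i. i \<ge> 1 \<Longrightarrow> distr M (count_space UNIV) (X i) = measure_pmf \<mu>"
begin

lemma indep_partial_sum:
  "indep_var (count_space UNIV) (partial_sum X n) (count_space UNIV) (X (Suc n))"
  by (rule indep_var_past[OF indep, where h = "\<lambda>f. \<Sum>i=1..n. f i"]) (simp add: partial_sum_def)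

lemma indep_backward_max:
  "indep_var (count_space UNIV) (backward_max X n) (count_space UNIV) (X (Suc n))"
\<comment> \<open>The same functional is applied on the space of trajectories, with the coordinate
  maps \<open>\<lambda>i f. f i\<close> in place of \<open>X\<close>.\<close>
proof (rule indep_var_past[OF indep, where h = "backward_max (\<lambda>i f. f i) n"])
  fix \<omega>
  have "(\<lambda>k. \<Sum>i=k..n. X i \<omega>) ` {1..n} = (\<lambda>k. \<Sum>i=k..n. restrict (\<lambda>i. X i \<omega>) {1..n} i) ` {1..n}"
    by (intro image_cong sum.cong) auto
  then show "backward_max X n \<omega> = backward_max (\<lambda>i f. f i) n (restrict (\<lambda>i. X i \<omega>) {1..n})"
    unfolding backward_max_def by (simp only:)
qed

lemma distr_partial_sum:
  "distr M (count_space UNIV) (partial_sum X n) = measure_pmf (conv_power_pmf \<mu> n)"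
proof (induction n)
  case 0
  then show ?case using distr_const_pmf[of 0] by (simp add: partial_sum_def[abs_def])
next
  case (Suc n)
  from distr_indep_pmf[OF indep_partial_sum Suc ident, of "(+)"] show ?case
    by (simp add: conv_pmf_def partial_sum_def[abs_def])
qed

lemma distr_backward_max:
  "distr M (count_space UNIV) (backward_max X n) = measure_pmf (map_pmf int (lindley_pmf \<mu> n))"
proof (induction n)
  case 0
  then show ?case using distr_const_pmf[of 0] by (simp add: backward_max_def[abs_def])
next
  case (Suc n)
  from distr_indep_pmf[OF indep_backward_max Suc ident, of "\<lambda>x y. max 0 (x + y)"]
  have "distr M (count_space UNIV) (backward_max X (Suc n)) =
    measure_pmf (map_pmf (\<lambda>(x, y). max 0 (x + y)) (pair_pmf (map_pmf int (lindley_pmf \<mu> n)) \<mu>))"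
    by (simp add: backward_max_Suc[abs_def])
  \<comment> \<open>Here \<open>max 0 x\<close> is factored as \<open>int (nat x)\<close>.\<close>
  also have "map_pmf (\<lambda>(x, y). max 0 (x + y)) (pair_pmf (map_pmf int (lindley_pmf \<mu> n)) \<mu>) =
    map_pmf int (lindley_pmf \<mu> (Suc n))"
    by (simp add: conv_pmf_def pmf.map_comp comp_def case_prod_unfold max_def)
  finally show ?case .
qed

lemma expectation_partial_sum:
  "(\<integral>\<omega>. z ^ nat (max 0 (partial_sum X n \<omega>)) \<partial>M) = pgf (map_pmf nat (conv_power_pmf \<mu> n)) z"
proof -
  have "(\<integral>\<omega>. z ^ nat (max 0 (partial_sum X n \<omega>)) \<partial>M) =
    (\<integral>x. z ^ nat x \<partial>distr M (count_space UNIV) (partial_sum X n))"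
    by (subst integral_distr) (auto intro: indep_var_rv1[OF indep_partial_sum] simp: max_def intro!: Bochner_Integration.integral_cong)
  then show ?thesis by (simp add: distr_partial_sum pgf_def)
qed

lemma expectation_backward_max:
  "(\<integral>\<omega>. z ^ nat (backward_max X n \<omega>) \<partial>M) = pgf (lindley_pmf \<mu> n) z"
proof -
  have "(\<integral>\<omega>. z ^ nat (backward_max X n \<omega>) \<partial>M) =
    (\<integral>x. z ^ nat x \<partial>distr M (count_space UNIV) (backward_max X n))"
    by (subst integral_distr) (auto intro: indep_var_rv1[OF indep_backward_max])
  then show ?thesis by (simp add: distr_backward_max pgf_def)
qed

end

theorem proposition2:
  fixes M :: "'a measure" and X :: "nat \<Rightarrow> 'a \<Rightarrow> int" and \<mu> :: "int pmf" and u z :: complex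
  assumes "prob_space M"
    and indep: "prob_space.indep_vars M (\<lambda>_. count_space UNIV) X {1..}"
    and ident: "\<And>i. i \<ge> 1 \<Longrightarrow> distr M (count_space UNIV) (X i) = measure_pmf \<mu>"
    and supp: "bdd_below (set_pmf \<mu>)"
    and "norm u < 1" and "norm z \<le> 1"
  shows "summable (\<lambda>l. u ^ Suc l / of_nat (Suc l) *
           (\<integral>\<omega>. z ^ nat (max 0 (partial_sum X (Suc l) \<omega>)) \<partial>M)) \<and>
         (\<lambda>n. u ^ n * (\<integral>\<omega>. z ^ nat (backward_max X n \<omega>) \<partial>M)) sums
         exp (\<Sum>l. u ^ Suc l / of_nat (Suc l) *
           (\<integral>\<omega>. z ^ nat (max 0 (partial_sum X (Suc l) \<omega>)) \<partial>M))"
proof -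
  interpret prob_space M by fact
  interpret lindley_walk M X \<mu> by unfold_locales (fact indep, fact ident)
  have "pgf (lindley_pmf \<mu> 0) z = 1" by (simp add: pgf_def)
  \<comment> \<open>Take the expectations for M_n as \<open>a n\<close> and those for the positive
    part of S_(l+1) as \<open>b l\<close>; both are bounded by 1 in norm, being expectations of
    powers of z.\<close>
  then show ?thesis
    unfolding expectation_partial_sum expectation_backward_max
    using spitzer_recursion_pgf[OF supp \<open>norm z \<le> 1\<close>] norm_pgf_le_1[OF \<open>norm z \<le> 1\<close>] \<open>norm u < 1\<close>
    by (intro conjI exp_power_series_sums)
qed

end
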